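(* Let $K$ be a small category and $G$ a group acting on $K$. For every integer $t\ge 2$ the following two assertions are equivalent: (1$_t$) Condition (C$_t$): if $m_1,\dots,m_{t-1},m_a,m_b\in\mathcal M(K)$ satisfy $\partial^\bullet m_i=\partial_\bullet m_{i-1}$ for all $2\le i\le t-1$, $\partial^\bullet m_a=\partial^\bullet m_b=\partial_\bullet m_{t-1}$, and $Gm_a=Gm_b$, then there is some $g\in G$ such that $gm_a=m_b$ and $gm_i=m_i$ for $1\le i\le t-1$. (2$_t$) The canonical surjection $\lambda:\Delta(K)/G\to\Delta(K/G)$ is injective on $t$-skeleta. In particular, $\lambda$ is an isomorphism if and only if Condition (C$_t$) is satisfied for all $t\ge2$.
   Context: For a small category $K$, $\mathcal O(K)$ is its set of objects and $\mathcal M(K)$ its set of morphisms; a morphism $m$ from $a$ to $b$ has $\partial^\bullet m=a$ (source) and $\partial_\bullet m=b$ (target). Composition is written in diagrammatic order: $x\circ y$ is defined when $\partial_\bullet x=\partial^\bullet y$. A group $G$ (viewed as a category with one object) acts on $K$ if there is a functor $\mathcal A_K:G\to\mathbf{Cat}$ ($\mathbf{Cat}$ = category of small categories) sending the unique object to $K$; thus each $g\in G$ acts as an automorphism of $K$. $Gx$ denotes the orbit of a morphism $x$. The quotient $K/G$ is the colimit of $\mathcal A_K$ in $\mathbf{Cat}$; $[m]$ denotes the image in $K/G$ of $m\in\mathcal M(K)$. $\Delta(K)$ is the nerve of $K$, a simplicial set whose $t$-simplices are the chains $(n_1,\dots,n_t)$ of morphisms with $\partial_\bullet n_{i-1}=\partial^\bullet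 n_i$ (objects for $t=0$). $G$ acts on $\Delta(K)$, and $\Delta(K)/G$ is the colimit of this action in simplicial sets, whose $t$-simplices are the orbits $G(n_1,\dots,n_t)$. The canonical map is $\lambda(G(n_1,\dots,n_t))=([n_1],\dots,[n_t])$, $\lambda(Ga)=[a]$ for objects $a$. *)

theory Defs
  imports "HOL-Algebra.Group_Action"
begin

section \<open>Small categories and functors\<close>

text \<open>Composition is written in diagrammatic order: \<open>Comp K m n\<close> is ``first \<open>m\<close>, then \<open>n\<close>'' and is
  meaningful only if \<open>Tgt K m = Src K n\<close>.\<close>

record ('o, 'm) category =
  Obj :: "'o set"
  Mor :: "'m set"
  Src :: "'m \<Rightarrow> 'o"
  Tgt :: "'m \<Rightarrow> 'o"
  Ident :: "'o \<Rightarrow> 'm"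
  Comp :: "'m \<Rightarrow> 'm \<Rightarrow> 'm"

locale category =
  fixes K :: "('o, 'm) category"
  assumes src_closed: "m \<in> Mor K \<Longrightarrow> Src K m \<in> Obj K"
    and tgt_closed: "m \<in> Mor K \<Longrightarrow> Tgt K m \<in> Obj K"
    and ident_closed: "a \<in> Obj K \<Longrightarrow> Ident K a \<in> Mor K"
    and src_ident: "a \<in> Obj K \<Longrightarrow> Src K (Ident K a) = a"
    and tgt_ident: "a \<in> Obj K \<Longrightarrow> Tgt K (Ident K a) = a"
    and comp_closed: "\<lbrakk>m \<in> Mor K; n \<in> Mor K; Tgt K m = Src K n\<rbrakk> \<Longrightarrow> Comp K m n \<in> Mor K"
    and src_comp: "\<lbrakk>m \<in> Mor K; n \<in> Mor K; Tgt K m = Src K n\<rbrakk> \<Longrightarrow> Src K (Comp K m n) = Src K m"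
    and tgt_comp: "\<lbrakk>m \<in> Mor K; n \<in> Mor K; Tgt K m = Src K n\<rbrakk> \<Longrightarrow> Tgt K (Comp K m n) = Tgt K n"
    and ident_comp: "m \<in> Mor K \<Longrightarrow> Comp K (Ident K (Src K m)) m = m"
    and comp_ident: "m \<in> Mor K \<Longrightarrow> Comp K m (Ident K (Tgt K m)) = m"
    and comp_assoc: "\<lbrakk>l \<in> Mor K; m \<in> Mor K; n \<in> Mor K; Tgt K l = Src K m; Tgt K m = Src K n\<rbrakk>
      \<Longrightarrow> Comp K (Comp K l m) n = Comp K l (Comp K m n)"

text \<open>A functor is given by its object map \<open>Fo\<close> and its morphism map \<open>Fm\<close>; only their values on
  \<open>Obj K\<close> and \<open>Mor K\<close> matter.\<close>

locale category_functor = source: category K + target: category L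
  for K :: "('o, 'm) category" and L :: "('p, 'n) category" +
  fixes Fo :: "'o \<Rightarrow> 'p" and Fm :: "'m \<Rightarrow> 'n"
  assumes obj_closed: "a \<in> Obj K \<Longrightarrow> Fo a \<in> Obj L"
    and mor_closed: "m \<in> Mor K \<Longrightarrow> Fm m \<in> Mor L"
    and map_src: "m \<in> Mor K \<Longrightarrow> Src L (Fm m) = Fo (Src K m)"
    and map_tgt: "m \<in> Mor K \<Longrightarrow> Tgt L (Fm m) = Fo (Tgt K m)"
    and map_ident: "a \<in> Obj K \<Longrightarrow> Fm (Ident K a) = Ident L (Fo a)"
    and map_comp: "\<lbrakk>m \<in> Mor K; n \<in> Mor K; Tgt K m = Src K n\<rbrakk>
      \<Longrightarrow> Fm (Comp K m n) = Comp L (Fm m) (Fm n)"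


section \<open>Group actions on categories\<close>

text \<open>A functor from \<open>G\<close> to the category of small categories that sends the unique object to \<open>K\<close>:
  every \<open>g\<close> gives an endofunctor \<open>(ao g, am g)\<close> of \<open>K\<close>, compatibly with units and products.
  It is written as a left action, \<open>(g h) x = g (h x)\<close>.\<close>

locale category_action = group G + category K
  for G (structure) and K :: "('o, 'm) category" +
  fixes ao :: "'g \<Rightarrow> 'o \<Rightarrow> 'o" and am :: "'g \<Rightarrow> 'm \<Rightarrow> 'm"
  constrains G :: "('g, 'b) monoid_scheme"
  assumes act_functor: "g \<in> carrier G \<Longrightarrow> category_functor K K (ao g) (am g)"
    and act_one_obj: "a \<in> Obj K \<Longrightarrow> ao \<one> a = a"
    and act_one_mor: "m \<in> Mor K \<Longrightarrow> am \<one> m = m"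
    and act_mult_obj: "\<lbrakk>g \<in> carrier G; h \<in> carrier G; a \<in> Obj K\<rbrakk> \<Longrightarrow> ao (g \<otimes> h) a = ao g (ao h a)"
    and act_mult_mor: "\<lbrakk>g \<in> carrier G; h \<in> carrier G; m \<in> Mor K\<rbrakk> \<Longrightarrow> am (g \<otimes> h) m = am g (am h m)"


section \<open>The quotient category\<close>

text \<open>\<open>K/G\<close> is the colimit of the action, constructed explicitly: its objects are the orbits of
  objects, its morphisms the classes of the least equivalence relation on \<open>Mor K\<close> that contains the
  orbit relation and is compatible with composition. The universal property, against categories over
  arbitrary types, is \<open>quotient_cocone\<close>, \<open>quotient_universal\<close> below.\<close>

inductive quot_rel :: "('g, 'b) monoid_scheme \<Rightarrow> ('o, 'm) category \<Rightarrow> ('g \<Rightarrow> 'm \<Rightarrow> 'm) \<Rightarrow> 'm \<Rightarrow> 'm \<Rightarrow> bool"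
  for G K am where
  act: "\<lbrakk>m \<in> Mor K; g \<in> carrier G\<rbrakk> \<Longrightarrow> quot_rel G K am m (am g m)"
| sym: "quot_rel G K am m n \<Longrightarrow> quot_rel G K am n m"
| trans: "\<lbrakk>quot_rel G K am l m; quot_rel G K am m n\<rbrakk> \<Longrightarrow> quot_rel G K am l n"
| comp: "\<lbrakk>quot_rel G K am m m'; quot_rel G K am n n'; Tgt K m = Src K n; Tgt K m' = Src K n'\<rbrakk>
    \<Longrightarrow> quot_rel G K am (Comp K m n) (Comp K m' n')"

definition mor_class :: "('g, 'b) monoid_scheme \<Rightarrow> ('o, 'm) category \<Rightarrow> ('g \<Rightarrow> 'm \<Rightarrow> 'm) \<Rightarrow> 'm \<Rightarrow> 'm set"
  where "mor_class G K am m = {n. quot_rel G K am m n}"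

text \<open>The sets below to which \<open>the_elem\<close> is applied are singletons
  (\<open>quotient_src\<close>, \<open>quotient_tgt\<close>, \<open>quotient_ident\<close>, \<open>quotient_comp\<close>).\<close>

definition quotient_category ::
  "('g, 'b) monoid_scheme \<Rightarrow> ('o, 'm) category \<Rightarrow> ('g \<Rightarrow> 'o \<Rightarrow> 'o) \<Rightarrow> ('g \<Rightarrow> 'm \<Rightarrow> 'm) \<Rightarrow> ('o set, 'm set) category"
  where "quotient_category G K ao am = \<lparr>
    Obj = orbit G ao ` Obj K,
    Mor = mor_class G K am ` Mor K,
    Src = (\<lambda>C. the_elem ((\<lambda>m. orbit G ao (Src K m)) ` C)),
    Tgt = (\<lambda>C. the_elem ((\<lambda>m. orbit G ao (Tgt K m)) ` C)),
    Ident = (\<lambda>A. the_elem ((\<lambda>a. mor_class G K am (Ident K a)) ` A)),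
    Comp = (\<lambda>C D. the_elem {mor_class G K am (Comp K m n) | m n. m \<in> C \<and> n \<in> D \<and> Tgt K m = Src K n})\<rparr>"


section \<open>Simplicial sets\<close>

text \<open>Simplicial sets are contravariant functors on the simplex category. Its morphisms \<open>[m] \<rightarrow> [n]\<close>
  are the monotone maps \<open>{..m} \<rightarrow> {..n}\<close>, represented by extensional functions.
  \<open>Pull X m n \<theta>\<close> is the map from \<open>n\<close>-simplices to \<open>m\<close>-simplices induced by \<open>\<theta> : [m] \<rightarrow> [n]\<close>.\<close>

definition simplex_maps :: "nat \<Rightarrow> nat \<Rightarrow> (nat \<Rightarrow> nat) set"
  where "simplex_maps m n = {\<theta> \<in> {..m} \<rightarrow>\<^sub>E {..n}. mono_on {..m} \<theta>}"

record 'a simplicial =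
  Simp :: "nat \<Rightarrow> 'a set"
  Pull :: "nat \<Rightarrow> nat \<Rightarrow> (nat \<Rightarrow> nat) \<Rightarrow> 'a \<Rightarrow> 'a"

locale simplicial_set =
  fixes X :: "'a simplicial"
  assumes pull_closed: "\<lbrakk>\<theta> \<in> simplex_maps m n; x \<in> Simp X n\<rbrakk> \<Longrightarrow> Pull X m n \<theta> x \<in> Simp X m"
    and pull_id: "x \<in> Simp X n \<Longrightarrow> Pull X n n (restrict (\<lambda>i. i) {..n}) x = x"
    and pull_comp: "\<lbrakk>\<theta> \<in> simplex_maps k m; \<phi> \<in> simplex_maps m n; x \<in> Simp X n\<rbrakk>
      \<Longrightarrow> Pull X k m \<theta> (Pull X m n \<phi> x) = Pull X k n (compose {..k} \<phi> \<theta>) x"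

text \<open>A simplicial map is a family of maps, one in every dimension.\<close>

definition simplicial_map :: "'a simplicial \<Rightarrow> 'b simplicial \<Rightarrow> (nat \<Rightarrow> 'a \<Rightarrow> 'b) \<Rightarrow> bool"
  where "simplicial_map X Y f \<longleftrightarrow>
    (\<forall>n. \<forall>x \<in> Simp X n. f n x \<in> Simp Y n) \<and>
    (\<forall>m n. \<forall>\<theta> \<in> simplex_maps m n. \<forall>x \<in> Simp X n. f m (Pull X m n \<theta> x) = Pull Y m n \<theta> (f n x))"

definition simplicial_iso :: "'a simplicial \<Rightarrow> 'b simplicial \<Rightarrow> (nat \<Rightarrow> 'a \<Rightarrow> 'b) \<Rightarrow> bool"
  where "simplicial_iso X Y f \<longleftrightarrow> simplicial_map X Y f \<and>
    (\<exists>f'. simplicial_map Y X f' \<and>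
      (\<forall>n. (\<forall>x \<in> Simp X n. f' n (f n x) = x) \<and> (\<forall>y \<in> Simp Y n. f n (f' n y) = y)))"

text \<open>The simplicial subset generated by the simplices of dimension at most \<open>t\<close>; it has simplices in
  every dimension.\<close>

definition skeleton :: "nat \<Rightarrow> 'a simplicial \<Rightarrow> 'a simplicial"
  where "skeleton t X = X \<lparr>Simp := (\<lambda>n. {Pull X n k \<theta> x | k \<theta> x.
    k \<le> t \<and> \<theta> \<in> simplex_maps n k \<and> x \<in> Simp X k})\<rparr>"

definition injective_on_skeleta :: "nat \<Rightarrow> 'a simplicial \<Rightarrow> (nat \<Rightarrow> 'a \<Rightarrow> 'b) \<Rightarrow> bool"
  where "injective_on_skeleta t X f \<longleftrightarrow> (\<forall>n. inj_on (f n) (Simp (skeleton t X) n))"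

text \<open>A group acting on a simplicial set, and the colimit of the action, formed dimensionwise. Its
  universal property is \<open>simplicial_quotient_cocone\<close>, \<open>simplicial_quotient_universal\<close> below.\<close>

locale simplicial_action = group G + simplicial_set X
  for G (structure) and X :: "'a simplicial" +
  fixes act :: "'g \<Rightarrow> 'a \<Rightarrow> 'a"
  constrains G :: "('g, 'b) monoid_scheme"
  assumes act_map: "g \<in> carrier G \<Longrightarrow> simplicial_map X X (\<lambda>n. act g)"
    and act_one: "x \<in> Simp X n \<Longrightarrow> act \<one> x = x"
    and act_mult: "\<lbrakk>g \<in> carrier G; h \<in> carrier G; x \<in> Simp X n\<rbrakk> \<Longrightarrow> act (g \<otimes> h) x = act g (act h x)"

definition simplicial_quotient ::
  "('g, 'b) monoid_scheme \<Rightarrow> 'a simplicial \<Rightarrow> ('g \<Rightarrow> 'a \<Rightarrow> 'a) \<Rightarrow> 'a set simplicial"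
  where "simplicial_quotient G X act = \<lparr>
    Simp = (\<lambda>n. orbit G act ` Simp X n),
    Pull = (\<lambda>m n \<theta> S. Pull X m n \<theta> ` S)\<rparr>"


section \<open>Nerves\<close>

text \<open>Simplices of dimension 0 are objects, those of dimension \<open>n > 0\<close> are chains of \<open>n\<close> composable
  morphisms; the list \<open>[n\<^sub>1, \<dots>, n\<^sub>t]\<close> is indexed from 0.\<close>

datatype ('o, 'm) nerve_simplex = Vertex 'o | Chain "'m list"

fun arrows :: "('o, 'm) nerve_simplex \<Rightarrow> 'm list" where
  "arrows (Vertex a) = []"
| "arrows (Chain ms) = ms"

fun vertex :: "('o, 'm) category \<Rightarrow> ('o, 'm) nerve_simplex \<Rightarrow> nat \<Rightarrow> 'o" where
  "vertex K (Vertex a) i = a"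
| "vertex K (Chain ms) i = (if i = 0 then Src K (hd ms) else Tgt K (ms ! (i - 1)))"

text \<open>The composite of the chain from its \<open>i\<close>-th to its \<open>j\<close>-th vertex, for \<open>i \<le> j\<close>
  (an identity if \<open>i = j\<close>).\<close>

definition edge :: "('o, 'm) category \<Rightarrow> ('o, 'm) nerve_simplex \<Rightarrow> nat \<Rightarrow> nat \<Rightarrow> 'm"
  where "edge K \<sigma> i j = foldl (Comp K) (Ident K (vertex K \<sigma> i)) (drop i (take j (arrows \<sigma>)))"

definition nerve :: "('o, 'm) category \<Rightarrow> ('o, 'm) nerve_simplex simplicial"
  where "nerve K = \<lparr>
    Simp = (\<lambda>n. if n = 0 then Vertex ` Obj K
      else {Chain ms | ms. length ms = n \<and> set ms \<subseteq> Mor K \<and>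
        (\<forall>i. Suc i < n \<longrightarrow> Tgt K (ms ! i) = Src K (ms ! Suc i))}),
    Pull = (\<lambda>m n \<theta> \<sigma>. if m = 0 then Vertex (vertex K \<sigma> (\<theta> 0))
      else Chain (map (\<lambda>i. edge K \<sigma> (\<theta> i) (\<theta> (Suc i))) [0..<m]))\<rparr>"

definition nerve_act ::
  "('g \<Rightarrow> 'o \<Rightarrow> 'o) \<Rightarrow> ('g \<Rightarrow> 'm \<Rightarrow> 'm) \<Rightarrow> 'g \<Rightarrow> ('o, 'm) nerve_simplex \<Rightarrow> ('o, 'm) nerve_simplex"
  where "nerve_act ao am g = map_nerve_simplex (ao g) (am g)"


section \<open>The canonical map and the condition on the action\<close>

text \<open>The canonical map sends the orbit of \<open>(n\<^sub>1, \<dots>, n\<^sub>t)\<close> to \<open>([n\<^sub>1], \<dots>, [n\<^sub>t])\<close>; the set below is a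
  singleton (\<open>canonical_map_orbit\<close>).\<close>

definition canonical_map ::
  "('g, 'b) monoid_scheme \<Rightarrow> ('o, 'm) category \<Rightarrow> ('g \<Rightarrow> 'o \<Rightarrow> 'o) \<Rightarrow> ('g \<Rightarrow> 'm \<Rightarrow> 'm)
    \<Rightarrow> nat \<Rightarrow> ('o, 'm) nerve_simplex set \<Rightarrow> ('o set, 'm set) nerve_simplex"
  where "canonical_map G K ao am n S =
    the_elem (map_nerve_simplex (orbit G ao) (mor_class G K am) ` S)"

definition condition_C ::
  "('g, 'b) monoid_scheme \<Rightarrow> ('o, 'm) category \<Rightarrow> ('g \<Rightarrow> 'm \<Rightarrow> 'm) \<Rightarrow> nat \<Rightarrow> bool"
  where "condition_C G K am t \<longleftrightarrow>
    (\<forall>m ma mb.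
      (\<forall>i \<in> {1..t-1}. m i \<in> Mor K) \<and> ma \<in> Mor K \<and> mb \<in> Mor K \<and>
      (\<forall>i \<in> {2..t-1}. Src K (m i) = Tgt K (m (i - 1))) \<and>
      Src K ma = Tgt K (m (t - 1)) \<and> Src K mb = Tgt K (m (t - 1)) \<and>
      orbit G am ma = orbit G am mb
      \<longrightarrow> (\<exists>g \<in> carrier G. am g ma = mb \<and> (\<forall>i \<in> {1..t-1}. am g (m i) = m i)))"


section \<open>The quotient category is the colimit of the action\<close>

lemma the_elem_image:
  assumes "x \<in> A" and "\<And>y. y \<in> A \<Longrightarrow> f y = f x"
  shows "the_elem (f ` A) = f x"
  by (rule the_elem_image_unique) (use assms in blast)+

context category_action
begin

abbreviation Q where "Q \<equiv> quotient_category G K ao am"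

lemma am_closed: "\<lbrakk>g \<in> carrier G; m \<in> Mor K\<rbrakk> \<Longrightarrow> am g m \<in> Mor K"
  and ao_closed: "\<lbrakk>g \<in> carrier G; a \<in> Obj K\<rbrakk> \<Longrightarrow> ao g a \<in> Obj K"
  and src_am: "\<lbrakk>g \<in> carrier G; m \<in> Mor K\<rbrakk> \<Longrightarrow> Src K (am g m) = ao g (Src K m)"
  and tgt_am: "\<lbrakk>g \<in> carrier G; m \<in> Mor K\<rbrakk> \<Longrightarrow> Tgt K (am g m) = ao g (Tgt K m)"
  and ident_am: "\<lbrakk>g \<in> carrier G; a \<in> Obj K\<rbrakk> \<Longrightarrow> am g (Ident K a) = Ident K (ao g a)"
  using category_functor.mor_closed[OF act_functor] category_functor.obj_closed[OF act_functor]
    category_functor.map_src[OF act_functor] category_functor.map_tgt[OF act_functor]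
    category_functor.map_ident[OF act_functor]
  by simp_all

lemma in_orbit_obj: "a \<in> Obj K \<Longrightarrow> a \<in> orbit G ao a"
  unfolding orbit_def using act_one_obj[of a] one_closed by force

lemma orbit_act_obj:
  assumes g: "g \<in> carrier G" and a: "a \<in> Obj K"
  shows "orbit G ao (ao g a) = orbit G ao a"
proof -
  have "ao h a \<in> orbit G ao (ao g a)" if h: "h \<in> carrier G" for h
  proof -
    have "ao (h \<otimes> inv g) (ao g a) = ao (h \<otimes> inv g \<otimes> g) a"
      using act_mult_obj[of "h \<otimes> inv g" g a] g h a by simp
    also have "h \<otimes> inv g \<otimes> g = h" using g h by (simp add: m_assoc)
    finally show ?thesis
      unfolding orbit_def using g h by (intro CollectI exI[of _ "h \<otimes> inv g"]) simp
  qed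
  moreover have "ao h (ao g a) \<in> orbit G ao a" if h: "h \<in> carrier G" for h
    unfolding orbit_def using act_mult_obj[OF h g a, symmetric] h g by blast
  ultimately show ?thesis unfolding orbit_def by blast
qed

lemma orbit_eq_objD:
  assumes "orbit G ao a = orbit G ao b" and "b \<in> Obj K"
  obtains g where "g \<in> carrier G" "b = ao g a"
  using assms in_orbit_obj[of b] unfolding orbit_def by blast

lemma orbit_obj_member: "\<lbrakk>a \<in> Obj K; b \<in> orbit G ao a\<rbrakk> \<Longrightarrow> b \<in> Obj K \<and> orbit G ao b = orbit G ao a"
  using orbit_act_obj ao_closed unfolding orbit_def by blast

lemma quot_rel_facts:
  assumes "quot_rel G K am m n"
  shows "m \<in> Mor K \<and> n \<in> Mor K \<and> orbit G ao (Src K m) = orbit G ao (Src K n)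
    \<and> orbit G ao (Tgt K m) = orbit G ao (Tgt K n)"
  using assms
proof induction
  case (act m g)
  then show ?case by (simp add: am_closed src_am tgt_am orbit_act_obj src_closed tgt_closed)
next
  case (comp m m' n n')
  then show ?case by (simp add: comp_closed src_comp tgt_comp)
qed auto

lemma quot_rel_refl: "m \<in> Mor K \<Longrightarrow> quot_rel G K am m m"
  using quot_rel.act[of m K "\<one>" G am] act_one_mor by simp

lemma in_mor_class: "m \<in> Mor K \<Longrightarrow> m \<in> mor_class G K am m"
  by (simp add: mor_class_def quot_rel_refl)

lemma mor_class_eq: "quot_rel G K am m n \<Longrightarrow> mor_class G K am m = mor_class G K am n"
  unfolding mor_class_def by (auto intro: quot_rel.sym quot_rel.trans)

lemma mor_class_eq_iff:
  "n \<in> Mor K \<Longrightarrow> mor_class G K am m = mor_class G K am n \<longleftrightarrow> quot_rel G K am m n"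
  using mor_class_eq[of m n] in_mor_class[of n] by (auto simp: mor_class_def)

lemma mor_class_act: "\<lbrakk>g \<in> carrier G; m \<in> Mor K\<rbrakk> \<Longrightarrow> mor_class G K am (am g m) = mor_class G K am m"
  using mor_class_eq quot_rel.act by metis

lemma quotient_src: "m \<in> Mor K \<Longrightarrow> Src Q (mor_class G K am m) = orbit G ao (Src K m)"
  unfolding quotient_category_def category.select_convs
  by (rule the_elem_image[OF in_mor_class]) (auto simp: mor_class_def dest: quot_rel_facts)

lemma quotient_tgt: "m \<in> Mor K \<Longrightarrow> Tgt Q (mor_class G K am m) = orbit G ao (Tgt K m)"
  unfolding quotient_category_def category.select_convs
  by (rule the_elem_image[OF in_mor_class]) (auto simp: mor_class_def dest: quot_rel_facts)

lemma quotient_ident: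
  assumes a: "a \<in> Obj K"
  shows "Ident Q (orbit G ao a) = mor_class G K am (Ident K a)"
  unfolding quotient_category_def category.select_convs
proof (rule the_elem_image[OF in_orbit_obj[OF a]])
  fix b assume "b \<in> orbit G ao a"
  then obtain g where "g \<in> carrier G" "b = ao g a" unfolding orbit_def by blast
  then show "mor_class G K am (Ident K b) = mor_class G K am (Ident K a)"
    using mor_class_act[OF _ ident_closed[OF a]] ident_am[OF _ a] by metis
qed

lemma quotient_comp:
  assumes m: "m \<in> Mor K" and n: "n \<in> Mor K" and mn: "Tgt K m = Src K n"
  shows "Comp Q (mor_class G K am m) (mor_class G K am n) = mor_class G K am (Comp K m n)"
proof -
  have "mor_class G K am (Comp K m' n') = mor_class G K am (Comp K m n)"
    if "m' \<in> mor_class G K am m" "n' \<in> mor_class G K am n" "Tgt K m' = Src K n'" for m' n'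
    using that mn mor_class_eq quot_rel.comp[of G K am m m' n n'] by (force simp: mor_class_def)
  then have "{mor_class G K am (Comp K m' n') | m' n'. m' \<in> mor_class G K am m \<and>
      n' \<in> mor_class G K am n \<and> Tgt K m' = Src K n'} = {mor_class G K am (Comp K m n)}"
    using in_mor_class[OF m] in_mor_class[OF n] mn by blast
  then show ?thesis unfolding quotient_category_def by simp
qed

lemma quotient_objE:
  assumes "A \<in> Obj Q"
  obtains a where "a \<in> Obj K" "A = orbit G ao a"
  using assms unfolding quotient_category_def by auto

lemma quotient_morE:
  assumes "C \<in> Mor Q"
  obtains m where "m \<in> Mor K" "C = mor_class G K am m"
  using assms unfolding quotient_category_def by auto

lemma quotient_obj: "a \<in> Obj K \<Longrightarrow> orbit G ao a \<in> Obj Q"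
  and quotient_mor: "m \<in> Mor K \<Longrightarrow> mor_class G K am m \<in> Mor Q"
  unfolding quotient_category_def by auto

lemma quotient_lift:
  assumes D: "D \<in> Mor Q" and a: "a \<in> Obj K" and "Src Q D = orbit G ao a"
  obtains n where "n \<in> Mor K" "D = mor_class G K am n" "Src K n = a"
proof -
  obtain n where n: "n \<in> Mor K" "D = mor_class G K am n" using quotient_morE[OF D] .
  with assms have "orbit G ao (Src K n) = orbit G ao a" by (simp add: quotient_src)
  then obtain g where "g \<in> carrier G" "a = ao g (Src K n)" using orbit_eq_objD a by metis
  then show thesis using that[of "am g n"] n by (simp add: am_closed mor_class_act src_am)
qed

lemma quotient_composableE:
  assumes "C \<in> Mor Q" "D \<in> Mor Q" "Tgt Q C = Src Q D"
  obtains m n where "m \<in> Mor K" "n \<in> Mor K" "C = mor_class G K am m" "D = mor_class G K am n"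
    "Tgt K m = Src K n"
proof -
  obtain m where m: "m \<in> Mor K" "C = mor_class G K am m" using quotient_morE assms(1) .
  then obtain n where "n \<in> Mor K" "D = mor_class G K am n" "Src K n = Tgt K m"
    using quotient_lift[OF assms(2) tgt_closed[OF m(1)]] assms(3) quotient_tgt by metis
  with m that show thesis by simp
qed

lemma quotient_is_category: "category Q"
proof
  fix C assume "C \<in> Mor Q"
  then obtain m where m: "m \<in> Mor K" "C = mor_class G K am m" using quotient_morE by blast
  then show "Src Q C \<in> Obj Q" "Tgt Q C \<in> Obj Q"
    by (simp_all add: quotient_src quotient_tgt quotient_obj src_closed tgt_closed)
  show "Comp Q (Ident Q (Src Q C)) C = C" "Comp Q C (Ident Q (Tgt Q C)) = C"
    using m by (simp_all add: quotient_src quotient_tgt quotient_ident src_closed tgt_closed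
        quotient_comp ident_closed src_ident tgt_ident ident_comp comp_ident)
next
  fix A assume "A \<in> Obj Q"
  then obtain a where "a \<in> Obj K" "A = orbit G ao a" using quotient_objE by blast
  then show "Ident Q A \<in> Mor Q" "Src Q (Ident Q A) = A" "Tgt Q (Ident Q A) = A"
    by (simp_all add: quotient_ident quotient_mor ident_closed quotient_src quotient_tgt
        src_ident tgt_ident)
next
  fix C D assume "C \<in> Mor Q" "D \<in> Mor Q" "Tgt Q C = Src Q D"
  then obtain m n where "m \<in> Mor K" "n \<in> Mor K" "C = mor_class G K am m" "D = mor_class G K am n"
    "Tgt K m = Src K n" using quotient_composableE by metis
  then show "Comp Q C D \<in> Mor Q" "Src Q (Comp Q C D) = Src Q C" "Tgt Q (Comp Q C D) = Tgt Q D"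
    by (simp_all add: quotient_comp quotient_mor comp_closed quotient_src quotient_tgt
        src_comp tgt_comp)
next
  fix C D E assume *: "C \<in> Mor Q" "D \<in> Mor Q" "E \<in> Mor Q" "Tgt Q C = Src Q D" "Tgt Q D = Src Q E"
  obtain l m where lm: "l \<in> Mor K" "m \<in> Mor K" "C = mor_class G K am l" "D = mor_class G K am m"
    "Tgt K l = Src K m" using quotient_composableE * by metis
  obtain n where n: "n \<in> Mor K" "E = mor_class G K am n" "Src K n = Tgt K m"
    using quotient_lift[OF *(3) tgt_closed[OF lm(2)]] *(5) lm quotient_tgt by metis
  show "Comp Q (Comp Q C D) E = Comp Q C (Comp Q D E)"
    using lm n by (simp add: quotient_comp comp_closed src_comp tgt_comp comp_assoc)
qed

lemma quotient_functor: "category_functor K Q (orbit G ao) (mor_class G K am)"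
proof -
  interpret Q: category Q by (rule quotient_is_category)
  show ?thesis
    by unfold_locales
      (simp_all add: quotient_obj quotient_mor quotient_src quotient_tgt quotient_ident quotient_comp)
qed

theorem quotient_cocone:
  "category_functor K Q (orbit G ao) (mor_class G K am)"
  "\<lbrakk>g \<in> carrier G; a \<in> Obj K\<rbrakk> \<Longrightarrow> orbit G ao (ao g a) = orbit G ao a"
  "\<lbrakk>g \<in> carrier G; m \<in> Mor K\<rbrakk> \<Longrightarrow> mor_class G K am (am g m) = mor_class G K am m"
  by (fact quotient_functor, fact orbit_act_obj, fact mor_class_act)

theorem quotient_universal:
  fixes T :: "('p, 'n) category"
  assumes F: "category_functor K T Fo Fm"
    and Fo: "\<And>g a. \<lbrakk>g \<in> carrier G; a \<in> Obj K\<rbrakk> \<Longrightarrow> Fo (ao g a) = Fo a"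
    and Fm: "\<And>g m. \<lbrakk>g \<in> carrier G; m \<in> Mor K\<rbrakk> \<Longrightarrow> Fm (am g m) = Fm m"
  shows "\<exists>Ho Hm. category_functor Q T Ho Hm
      \<and> (\<forall>a \<in> Obj K. Ho (orbit G ao a) = Fo a) \<and> (\<forall>m \<in> Mor K. Hm (mor_class G K am m) = Fm m)
      \<and> (\<forall>Ho' Hm'. category_functor Q T Ho' Hm'
          \<and> (\<forall>a \<in> Obj K. Ho' (orbit G ao a) = Fo a) \<and> (\<forall>m \<in> Mor K. Hm' (mor_class G K am m) = Fm m)
        \<longrightarrow> (\<forall>A \<in> Obj Q. Ho' A = Ho A) \<and> (\<forall>C \<in> Mor Q. Hm' C = Hm C))"
proof -
  interpret F: category_functor K T Fo Fm by (rule F)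
  interpret Q: category Q by (rule quotient_is_category)
  have rel: "Fm m = Fm n" if "quot_rel G K am m n" for m n
    using that
  proof induction
    case (comp m m' n n')
    then show ?case using quot_rel_facts by (metis F.map_comp)
  qed (simp_all add: Fm)
  define Ho where "Ho A = the_elem (Fo ` A)" for A
  define Hm where "Hm C = the_elem (Fm ` C)" for C
  have Ho: "Ho (orbit G ao a) = Fo a" if "a \<in> Obj K" for a
    unfolding Ho_def
    by (rule the_elem_image[OF in_orbit_obj[OF that]]) (use Fo that in \<open>auto simp: orbit_def\<close>)
  have Hm: "Hm (mor_class G K am m) = Fm m" if "m \<in> Mor K" for m
    unfolding Hm_def
    by (rule the_elem_image[OF in_mor_class[OF that]]) (use rel in \<open>auto simp: mor_class_def\<close>)
  have "category_functor Q T Ho Hm"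
  proof
    fix A assume "A \<in> Obj Q"
    then obtain a where "a \<in> Obj K" "A = orbit G ao a" using quotient_objE by blast
    then show "Ho A \<in> Obj T" "Hm (Ident Q A) = Ident T (Ho A)"
      by (simp_all add: Ho Hm quotient_ident ident_closed F.obj_closed F.map_ident)
  next
    fix C assume "C \<in> Mor Q"
    then obtain m where "m \<in> Mor K" "C = mor_class G K am m" using quotient_morE by blast
    then show "Hm C \<in> Mor T" "Src T (Hm C) = Ho (Src Q C)" "Tgt T (Hm C) = Ho (Tgt Q C)"
      by (simp_all add: Ho Hm quotient_src quotient_tgt src_closed tgt_closed F.mor_closed
          F.map_src F.map_tgt)
  next
    fix C D assume "C \<in> Mor Q" "D \<in> Mor Q" "Tgt Q C = Src Q D"
    then obtain m n where "m \<in> Mor K" "n \<in> Mor K" "C = mor_class G K am m" "D = mor_class G K am n"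
      "Tgt K m = Src K n" using quotient_composableE by metis
    then show "Hm (Comp Q C D) = Comp T (Hm C) (Hm D)"
      by (simp add: quotient_comp Hm comp_closed F.map_comp)
  qed
  moreover have "\<forall>A \<in> Obj Q. Ho' A = Ho A" if "\<forall>a \<in> Obj K. Ho' (orbit G ao a) = Fo a" for Ho'
    using that Ho quotient_objE by metis
  moreover have "\<forall>C \<in> Mor Q. Hm' C = Hm C" if "\<forall>m \<in> Mor K. Hm' (mor_class G K am m) = Fm m" for Hm'
    using that Hm quotient_morE by metis
  ultimately show ?thesis using Ho Hm by blast
qed

end


section \<open>The quotient of a simplicial set is the colimit of the action\<close>

context simplicial_action
begin

abbreviation QX where "QX \<equiv> simplicial_quotient G X act"

lemma act_closed: "\<lbrakk>g \<in> carrier G; x \<in> Simp X n\<rbrakk> \<Longrightarrow> act g x \<in> Simp X n"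
  using act_map unfolding simplicial_map_def by blast

lemma act_pull: "\<lbrakk>g \<in> carrier G; \<theta> \<in> simplex_maps m n; x \<in> Simp X n\<rbrakk>
    \<Longrightarrow> act g (Pull X m n \<theta> x) = Pull X m n \<theta> (act g x)"
  using act_map unfolding simplicial_map_def by blast

lemma in_orbit: "x \<in> Simp X n \<Longrightarrow> x \<in> orbit G act x"
  unfolding orbit_def using act_one[of x n] one_closed by force

lemma orbit_act:
  assumes g: "g \<in> carrier G" and x: "x \<in> Simp X n"
  shows "orbit G act (act g x) = orbit G act x"
proof -
  have "act h x \<in> orbit G act (act g x)" if h: "h \<in> carrier G" for h
  proof -
    have "act (h \<otimes> inv g) (act g x) = act (h \<otimes> inv g \<otimes> g) x"
      using act_mult[of "h \<otimes> inv g" g x n] g h x by simp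
    also have "h \<otimes> inv g \<otimes> g = h" using g h by (simp add: m_assoc)
    finally show ?thesis
      unfolding orbit_def using g h by (intro CollectI exI[of _ "h \<otimes> inv g"]) simp
  qed
  moreover have "act h (act g x) \<in> orbit G act x" if h: "h \<in> carrier G" for h
    unfolding orbit_def using act_mult[OF h g x, symmetric] h g by blast
  ultimately show ?thesis unfolding orbit_def by blast
qed

lemma pull_orbit:
  assumes "\<theta> \<in> simplex_maps m n" "x \<in> Simp X n"
  shows "Pull QX m n \<theta> (orbit G act x) = orbit G act (Pull X m n \<theta> x)"
  unfolding simplicial_quotient_def orbit_def using act_pull[OF _ assms]
  by (auto simp: image_def) metis

lemma quotient_simplexE:
  assumes "S \<in> Simp QX n"
  obtains x where "x \<in> Simp X n" "S = orbit G act x"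
  using assms unfolding simplicial_quotient_def by auto

lemma quotient_simplex: "x \<in> Simp X n \<Longrightarrow> orbit G act x \<in> Simp QX n"
  unfolding simplicial_quotient_def by auto

lemma simplex_maps_id: "restrict (\<lambda>i. i) {..n} \<in> simplex_maps n n"
  unfolding simplex_maps_def by (auto simp: mono_on_def)

lemma simplex_maps_compose:
  "\<lbrakk>\<theta> \<in> simplex_maps k m; \<phi> \<in> simplex_maps m n\<rbrakk> \<Longrightarrow> compose {..k} \<phi> \<theta> \<in> simplex_maps k n"
  unfolding simplex_maps_def compose_def by (auto simp: mono_on_def PiE_iff)

theorem simplicial_quotient_cocone:
  "simplicial_set QX"
  "simplicial_map X QX (\<lambda>n. orbit G act)"
  "\<lbrakk>g \<in> carrier G; x \<in> Simp X n\<rbrakk> \<Longrightarrow> orbit G act (act g x) = orbit G act x"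
proof -
  show "simplicial_set QX"
    by unfold_locales
      (auto elim!: quotient_simplexE simp: pull_orbit pull_closed pull_id pull_comp
        simplex_maps_id simplex_maps_compose intro!: quotient_simplex)
  show "simplicial_map X QX (\<lambda>n. orbit G act)"
    unfolding simplicial_map_def by (simp add: quotient_simplex pull_orbit)
  show "\<lbrakk>g \<in> carrier G; x \<in> Simp X n\<rbrakk> \<Longrightarrow> orbit G act (act g x) = orbit G act x"
    by (fact orbit_act)
qed

theorem simplicial_quotient_universal:
  fixes Y :: "'c simplicial"
  assumes f: "simplicial_map X Y f"
    and inv: "\<And>g n x. \<lbrakk>g \<in> carrier G; x \<in> Simp X n\<rbrakk> \<Longrightarrow> f n (act g x) = f n x"
  shows "\<exists>h. simplicial_map QX Y h \<and> (\<forall>n. \<forall>x \<in> Simp X n. h n (orbit G act x) = f n x)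
      \<and> (\<forall>h'. simplicial_map QX Y h' \<and> (\<forall>n. \<forall>x \<in> Simp X n. h' n (orbit G act x) = f n x)
        \<longrightarrow> (\<forall>n. \<forall>S \<in> Simp QX n. h' n S = h n S))"
proof -
  define h where "h n S = the_elem (f n ` S)" for n S
  have h: "h n (orbit G act x) = f n x" if "x \<in> Simp X n" for n x
    unfolding h_def
    by (rule the_elem_image[OF in_orbit[OF that]]) (use inv that in \<open>auto simp: orbit_def\<close>)
  have "simplicial_map QX Y h"
    using f unfolding simplicial_map_def
    by (auto elim!: quotient_simplexE simp: pull_orbit h pull_closed)
  moreover have "\<forall>n. \<forall>S \<in> Simp QX n. h' n S = h n S"
    if "\<forall>n. \<forall>x \<in> Simp X n. h' n (orbit G act x) = f n x" for h'
    using that h quotient_simplexE by metis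
  ultimately show ?thesis using h by blast
qed

end


section \<open>The nerve is a simplicial set, functorially\<close>

context category
begin

lemma nerve_simplexD:
  assumes "\<sigma> \<in> Simp (nerve K) n"
  shows "length (arrows \<sigma>) = n"
    and "i < n \<Longrightarrow> arrows \<sigma> ! i \<in> Mor K"
    and "i < n \<Longrightarrow> Src K (arrows \<sigma> ! i) = vertex K \<sigma> i"
    and "i < n \<Longrightarrow> Tgt K (arrows \<sigma> ! i) = vertex K \<sigma> (Suc i)"
    and "i \<le> n \<Longrightarrow> vertex K \<sigma> i \<in> Obj K"
proof -
  show len: "length (arrows \<sigma>) = n"
    using assms by (auto simp: nerve_def split: if_splits)
  show mor: "arrows \<sigma> ! i \<in> Mor K" if "i < n" for i
    using assms that by (auto simp: nerve_def split: if_splits)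
  show src: "Src K (arrows \<sigma> ! i) = vertex K \<sigma> i" if "i < n" for i
    using assms that by (cases i) (auto simp: nerve_def hd_conv_nth split: if_splits)
  show tgt: "Tgt K (arrows \<sigma> ! i) = vertex K \<sigma> (Suc i)" if "i < n" for i
    using assms that by (auto simp: nerve_def split: if_splits)
  show "vertex K \<sigma> i \<in> Obj K" if i: "i \<le> n" for i
  proof (cases "n = 0")
    case True
    then show ?thesis using assms by (auto simp: nerve_def)
  next
    case False
    then show ?thesis
      using i src[of 0] tgt[of "i - 1"] mor[of 0] mor[of "i - 1"] src_closed tgt_closed
      by (cases i) (metis gr0I, metis Suc_le_eq diff_Suc_1)
  qed
qed

lemma nerve_simplex_eqI:
  assumes "\<sigma> \<in> Simp (nerve K) n" "\<tau> \<in> Simp (nerve K) n"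
    and "vertex K \<sigma> 0 = vertex K \<tau> 0" and "\<And>i. i < n \<Longrightarrow> arrows \<sigma> ! i = arrows \<tau> ! i"
  shows "\<sigma> = \<tau>"
  using assms by (cases "n = 0") (auto simp: nerve_def intro: nth_equalityI)

lemma edge_refl: "edge K \<sigma> i i = Ident K (vertex K \<sigma> i)"
  unfolding edge_def by simp

lemma edge_Suc:
  assumes "\<sigma> \<in> Simp (nerve K) n" "i \<le> j" "j < n"
  shows "edge K \<sigma> i (Suc j) = Comp K (edge K \<sigma> i j) (arrows \<sigma> ! j)"
  unfolding edge_def using nerve_simplexD(1)[OF assms(1)] assms(2,3)
  by (simp add: take_Suc_conv_app_nth)

lemma edge_facts:
  assumes \<sigma>: "\<sigma> \<in> Simp (nerve K) n" and "i \<le> j" "j \<le> n"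
  shows "edge K \<sigma> i j \<in> Mor K \<and> Src K (edge K \<sigma> i j) = vertex K \<sigma> i
    \<and> Tgt K (edge K \<sigma> i j) = vertex K \<sigma> j"
  using assms(2,3)
proof (induction j rule: dec_induct)
  case base
  then show ?case
    using nerve_simplexD[OF \<sigma>] by (simp add: edge_refl ident_closed src_ident tgt_ident)
next
  case (step j)
  then show ?case using nerve_simplexD[OF \<sigma>] edge_Suc[OF \<sigma>]
    by (simp add: comp_closed src_comp tgt_comp)
qed

lemma edge_single:
  assumes \<sigma>: "\<sigma> \<in> Simp (nerve K) n" and "i < n"
  shows "edge K \<sigma> i (Suc i) = arrows \<sigma> ! i"
  using edge_Suc[OF \<sigma>, of i i] assms(2) nerve_simplexD[OF \<sigma>] ident_comp
  by (metis edge_refl order_refl)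

lemma edge_comp:
  assumes \<sigma>: "\<sigma> \<in> Simp (nerve K) n" and "i \<le> j" "j \<le> k" "k \<le> n"
  shows "Comp K (edge K \<sigma> i j) (edge K \<sigma> j k) = edge K \<sigma> i k"
  using assms(3,4)
proof (induction k rule: dec_induct)
  case base
  then show ?case using edge_facts[OF \<sigma> assms(2)] comp_ident by (metis edge_refl)
next
  case (step k)
  have "Comp K (edge K \<sigma> i j) (edge K \<sigma> j (Suc k))
      = Comp K (Comp K (edge K \<sigma> i j) (edge K \<sigma> j k)) (arrows \<sigma> ! k)"
    using step.hyps step.prems edge_facts[OF \<sigma>] nerve_simplexD[OF \<sigma>] assms(2)
    by (simp add: edge_Suc[OF \<sigma>] comp_assoc)
  with step assms(2) show ?case by (simp add: edge_Suc[OF \<sigma>])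
qed

lemma simplex_mapsD:
  assumes "\<theta> \<in> simplex_maps m n"
  shows "i \<le> m \<Longrightarrow> \<theta> i \<le> n" and "\<lbrakk>i \<le> j; j \<le> m\<rbrakk> \<Longrightarrow> \<theta> i \<le> \<theta> j"
  using assms unfolding simplex_maps_def by (auto simp: mono_on_def)

lemma pull_closed:
  assumes \<theta>: "\<theta> \<in> simplex_maps m n" and \<sigma>: "\<sigma> \<in> Simp (nerve K) n"
  shows "Pull (nerve K) m n \<theta> \<sigma> \<in> Simp (nerve K) m"
proof -
  have "edge K \<sigma> (\<theta> i) (\<theta> (Suc i)) \<in> Mor K
      \<and> Src K (edge K \<sigma> (\<theta> i) (\<theta> (Suc i))) = vertex K \<sigma> (\<theta> i)
      \<and> Tgt K (edge K \<sigma> (\<theta> i) (\<theta> (Suc i))) = vertex K \<sigma> (\<theta> (Suc i))" if "i < m" for i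
    using that edge_facts[OF \<sigma>] simplex_mapsD[OF \<theta>] by simp
  then show ?thesis
    using nerve_simplexD(5)[OF \<sigma>] simplex_mapsD[OF \<theta>]
    by (auto simp: nerve_def)
qed

lemma arrows_pull:
  "i < m \<Longrightarrow> arrows (Pull (nerve K) m n \<theta> \<sigma>) ! i = edge K \<sigma> (\<theta> i) (\<theta> (Suc i))"
  by (simp add: nerve_def)

lemma vertex_pull:
  assumes \<theta>: "\<theta> \<in> simplex_maps m n" and \<sigma>: "\<sigma> \<in> Simp (nerve K) n" and "i \<le> m"
  shows "vertex K (Pull (nerve K) m n \<theta> \<sigma>) i = vertex K \<sigma> (\<theta> i)"
proof (cases "i < m")
  case True
  then have "vertex K (Pull (nerve K) m n \<theta> \<sigma>) i = Src K (edge K \<sigma> (\<theta> i) (\<theta> (Suc i)))"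
    using nerve_simplexD(3)[OF pull_closed[OF \<theta> \<sigma>]] arrows_pull by metis
  then show ?thesis using edge_facts[OF \<sigma>] simplex_mapsD[OF \<theta>] True by simp
next
  case False
  then have im: "i = m" using assms(3) by simp
  show ?thesis
  proof (cases m)
    case 0
    then show ?thesis using im by (simp add: nerve_def)
  next
    case (Suc k)
    then have "vertex K (Pull (nerve K) m n \<theta> \<sigma>) i = Tgt K (edge K \<sigma> (\<theta> k) (\<theta> (Suc k)))"
      using nerve_simplexD(4)[OF pull_closed[OF \<theta> \<sigma>]] arrows_pull im by (metis lessI)
    then show ?thesis using edge_facts[OF \<sigma>] simplex_mapsD[OF \<theta>] im Suc by simp
  qed
qed

lemma edge_pull:
  assumes \<theta>: "\<theta> \<in> simplex_maps m n" and \<sigma>: "\<sigma> \<in> Simp (nerve K) n" and "i \<le> j" "j \<le> m"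
  shows "edge K (Pull (nerve K) m n \<theta> \<sigma>) i j = edge K \<sigma> (\<theta> i) (\<theta> j)"
  using assms(3,4)
proof (induction j rule: dec_induct)
  case base
  then show ?case using vertex_pull[OF \<theta> \<sigma>] by (simp add: edge_refl)
next
  case (step j)
  then show ?case
    using edge_Suc[OF pull_closed[OF \<theta> \<sigma>], of i j] edge_comp[OF \<sigma>] simplex_mapsD[OF \<theta>]
    by (simp add: arrows_pull)
qed

theorem nerve_simplicial_set: "simplicial_set (nerve K)"
proof
  fix \<theta> m n \<sigma> assume "\<theta> \<in> simplex_maps m n" "\<sigma> \<in> Simp (nerve K) n"
  then show "Pull (nerve K) m n \<theta> \<sigma> \<in> Simp (nerve K) m" by (rule pull_closed)
next
  fix n \<sigma> assume \<sigma>: "\<sigma> \<in> Simp (nerve K) n"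
  have id: "restrict (\<lambda>i. i) {..n} \<in> simplex_maps n n"
    unfolding simplex_maps_def by (auto simp: mono_on_def)
  show "Pull (nerve K) n n (restrict (\<lambda>i. i) {..n}) \<sigma> = \<sigma>"
    by (rule nerve_simplex_eqI[OF pull_closed[OF id \<sigma>] \<sigma>])
      (simp_all add: vertex_pull[OF id \<sigma>] arrows_pull edge_single[OF \<sigma>])
next
  fix \<theta> k m \<phi> n \<sigma>
  assume \<theta>: "\<theta> \<in> simplex_maps k m" and \<phi>: "\<phi> \<in> simplex_maps m n" and \<sigma>: "\<sigma> \<in> Simp (nerve K) n"
  have c: "compose {..k} \<phi> \<theta> \<in> simplex_maps k n"
    using \<theta> \<phi> unfolding simplex_maps_def compose_def by (auto simp: mono_on_def PiE_iff)
  note p = pull_closed[OF \<phi> \<sigma>]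
  show "Pull (nerve K) k m \<theta> (Pull (nerve K) m n \<phi> \<sigma>) = Pull (nerve K) k n (compose {..k} \<phi> \<theta>) \<sigma>"
    by (rule nerve_simplex_eqI[OF pull_closed[OF \<theta> p] pull_closed[OF c \<sigma>]])
      (simp_all add: vertex_pull[OF \<theta> p] vertex_pull[OF \<phi> \<sigma>] vertex_pull[OF c \<sigma>] arrows_pull
        edge_pull[OF \<phi> \<sigma>] simplex_mapsD[OF \<theta>] compose_eq)
qed

end

context category_functor
begin

lemma arrows_map: "arrows (map_nerve_simplex Fo Fm \<sigma>) = map Fm (arrows \<sigma>)"
  by (cases \<sigma>) simp_all

lemma vertex_map:
  assumes "\<sigma> \<in> Simp (nerve K) n" "i \<le> n"
  shows "vertex L (map_nerve_simplex Fo Fm \<sigma>) i = Fo (vertex K \<sigma> i)"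
  using assms by (cases \<sigma>) (auto simp: nerve_def hd_map map_src map_tgt subset_iff split: if_splits)

lemma nerve_map_closed:
  assumes "\<sigma> \<in> Simp (nerve K) n"
  shows "map_nerve_simplex Fo Fm \<sigma> \<in> Simp (nerve L) n"
  using assms by (cases \<sigma>)
    (auto simp: nerve_def obj_closed mor_closed map_src map_tgt subset_iff split: if_splits)

lemma edge_map:
  assumes \<sigma>: "\<sigma> \<in> Simp (nerve K) n" and "i \<le> j" "j \<le> n"
  shows "edge L (map_nerve_simplex Fo Fm \<sigma>) i j = Fm (edge K \<sigma> i j)"
  using assms(2,3)
proof (induction j rule: dec_induct)
  case base
  then show ?case using source.nerve_simplexD(5)[OF \<sigma>]
    by (simp add: source.edge_refl target.edge_refl vertex_map[OF \<sigma>] map_ident)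
next
  case (step j)
  then show ?case
    using source.nerve_simplexD[OF \<sigma>] source.edge_facts[OF \<sigma>]
    by (simp add: target.edge_Suc[OF nerve_map_closed[OF \<sigma>]] source.edge_Suc[OF \<sigma>] arrows_map map_comp)
qed

theorem nerve_map: "simplicial_map (nerve K) (nerve L) (\<lambda>n. map_nerve_simplex Fo Fm)"
  unfolding simplicial_map_def
proof (intro conjI allI ballI)
  fix n \<sigma> assume "\<sigma> \<in> Simp (nerve K) n"
  then show "map_nerve_simplex Fo Fm \<sigma> \<in> Simp (nerve L) n" by (rule nerve_map_closed)
next
  fix m n \<theta> \<sigma> assume \<theta>: "\<theta> \<in> simplex_maps m n" and \<sigma>: "\<sigma> \<in> Simp (nerve K) n"
  note p = source.pull_closed[OF \<theta> \<sigma>]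
  note f = nerve_map_closed[OF \<sigma>]
  show "map_nerve_simplex Fo Fm (Pull (nerve K) m n \<theta> \<sigma>)
      = Pull (nerve L) m n \<theta> (map_nerve_simplex Fo Fm \<sigma>)"
    by (rule target.nerve_simplex_eqI[OF nerve_map_closed[OF p] target.pull_closed[OF \<theta> f]])
      (simp_all add: vertex_map[OF p] source.vertex_pull[OF \<theta> \<sigma>] target.vertex_pull[OF \<theta> f]
        vertex_map[OF \<sigma>] arrows_map source.nerve_simplexD(1)[OF p] source.arrows_pull
        target.arrows_pull edge_map[OF \<sigma>] source.simplex_mapsD[OF \<theta>])
qed

end

context category_action
begin

theorem nerve_action: "simplicial_action G (nerve K) (nerve_act ao am)"
proof -
  interpret N: simplicial_set "nerve K" by (rule nerve_simplicial_set)
  show ?thesis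
  proof
    fix g assume "g \<in> carrier G"
    then show "simplicial_map (nerve K) (nerve K) (\<lambda>n. nerve_act ao am g)"
      unfolding nerve_act_def using category_functor.nerve_map act_functor by blast
  next
    fix \<sigma> n assume "\<sigma> \<in> Simp (nerve K) n"
    then show "nerve_act ao am \<one> \<sigma> = \<sigma>"
      by (cases \<sigma>) (auto simp: nerve_act_def nerve_def act_one_obj act_one_mor subset_iff
          map_idI split: if_splits)
  next
    fix g h \<sigma> n assume "g \<in> carrier G" "h \<in> carrier G" "\<sigma> \<in> Simp (nerve K) n"
    then show "nerve_act ao am (g \<otimes> h) \<sigma> = nerve_act ao am g (nerve_act ao am h \<sigma>)"
      by (cases \<sigma>) (auto simp: nerve_act_def nerve_def act_mult_obj act_mult_mor subset_iff
          split: if_splits)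
  qed
qed

theorem canonical_map_orbit:
  assumes \<sigma>: "\<sigma> \<in> Simp (nerve K) n"
  shows "canonical_map G K ao am n (orbit G (nerve_act ao am) \<sigma>)
    = map_nerve_simplex (orbit G ao) (mor_class G K am) \<sigma>"
  unfolding canonical_map_def
proof (rule the_elem_image)
  show "\<sigma> \<in> orbit G (nerve_act ao am) \<sigma>"
    using simplicial_action.in_orbit[OF nerve_action \<sigma>] .
  fix \<tau> assume "\<tau> \<in> orbit G (nerve_act ao am) \<sigma>"
  then obtain g where "g \<in> carrier G" "\<tau> = nerve_act ao am g \<sigma>" unfolding orbit_def by blast
  then show "map_nerve_simplex (orbit G ao) (mor_class G K am) \<tau>
      = map_nerve_simplex (orbit G ao) (mor_class G K am) \<sigma>"
    using \<sigma> by (cases \<sigma>) (auto simp: nerve_act_def nerve_def orbit_act_obj mor_class_act subset_iff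
        split: if_splits)
qed

theorem canonical_map_simplicial:
  "simplicial_map (simplicial_quotient G (nerve K) (nerve_act ao am)) (nerve Q) (canonical_map G K ao am)"
proof -
  interpret N: simplicial_action G "nerve K" "nerve_act ao am" by (rule nerve_action)
  show ?thesis
    using category_functor.nerve_map[OF quotient_functor] unfolding simplicial_map_def
    by (auto elim!: N.quotient_simplexE simp: N.pull_orbit canonical_map_orbit N.pull_closed)
qed

lemma chain_lift:
  assumes "Cs \<noteq> []" "set Cs \<subseteq> Mor Q" "\<forall>i. Suc i < length Cs \<longrightarrow> Tgt Q (Cs ! i) = Src Q (Cs ! Suc i)"
  shows "\<exists>ms. map (mor_class G K am) ms = Cs \<and> set ms \<subseteq> Mor K
    \<and> (\<forall>i. Suc i < length ms \<longrightarrow> Tgt K (ms ! i) = Src K (ms ! Suc i))"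
  using assms
proof (induction Cs rule: rev_nonempty_induct)
  case (single C)
  then obtain m where "m \<in> Mor K" "C = mor_class G K am m" using quotient_morE[of C] by auto
  then show ?case by (intro exI[of _ "[m]"]) simp
next
  case (snoc C Cs)
  have "\<forall>i. Suc i < length Cs \<longrightarrow> Tgt Q (Cs ! i) = Src Q (Cs ! Suc i)"
  proof (intro allI impI)
    fix i assume "Suc i < length Cs"
    with snoc.prems(2) show "Tgt Q (Cs ! i) = Src Q (Cs ! Suc i)"
      by (auto simp: nth_append dest!: spec[of _ i])
  qed
  then obtain ms where ms: "map (mor_class G K am) ms = Cs" "set ms \<subseteq> Mor K"
    "\<forall>i. Suc i < length ms \<longrightarrow> Tgt K (ms ! i) = Src K (ms ! Suc i)"
    using snoc by auto
  then have ne: "ms \<noteq> []" using snoc.hyps by auto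
  then have last: "last ms \<in> Mor K" using ms(2) last_in_set by blast
  have "Src Q C = Tgt Q (last Cs)"
    using snoc.prems(2) snoc.hyps
    by (auto simp: nth_append last_conv_nth dest!: spec[of _ "length Cs - 1"])
  also have "\<dots> = orbit G ao (Tgt K (last ms))"
    using ms(1) ne last by (auto simp: last_map quotient_tgt)
  finally obtain n where n: "n \<in> Mor K" "C = mor_class G K am n" "Src K n = Tgt K (last ms)"
    using quotient_lift[of C "Tgt K (last ms)"] snoc.prems(1) tgt_closed[OF last] by auto
  have "Tgt K ((ms @ [n]) ! i) = Src K ((ms @ [n]) ! Suc i)" if "Suc i < length (ms @ [n])" for i
    using that ms(3) n(3) ne
  proof (cases "Suc i < length ms")
    case True
    with ms(3) show ?thesis by (simp add: nth_append)
  next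
    case False
    with that have "i = length ms - 1" "i < length ms" "Suc i = length ms" by auto
    with n(3) ne show ?thesis by (simp add: nth_append last_conv_nth)
  qed
  then show ?case using ms n by (intro exI[of _ "ms @ [n]"]) auto
qed

theorem canonical_map_surj:
  assumes \<tau>: "\<tau> \<in> Simp (nerve Q) n"
  shows "\<exists>S \<in> Simp (simplicial_quotient G (nerve K) (nerve_act ao am)) n.
    canonical_map G K ao am n S = \<tau>"
proof -
  have "\<exists>\<sigma> \<in> Simp (nerve K) n. map_nerve_simplex (orbit G ao) (mor_class G K am) \<sigma> = \<tau>"
  proof (cases \<tau>)
    case (Vertex A)
    then show ?thesis using \<tau> by (auto simp: nerve_def split: if_splits elim!: quotient_objE)
  next
    case (Chain Cs)
    with \<tau> have Cs: "Cs \<noteq> []" "set Cs \<subseteq> Mor Q" "length Cs = n" "n \<noteq> 0"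
      "\<forall>i. Suc i < length Cs \<longrightarrow> Tgt Q (Cs ! i) = Src Q (Cs ! Suc i)"
      by (auto simp: nerve_def split: if_splits)
    then obtain ms where "map (mor_class G K am) ms = Cs" "set ms \<subseteq> Mor K"
      "\<forall>i. Suc i < length ms \<longrightarrow> Tgt K (ms ! i) = Src K (ms ! Suc i)"
      using chain_lift by blast
    then show ?thesis using Cs Chain
      by (intro bexI[of _ "nerve_simplex.Chain ms"]) (auto simp: nerve_def)
  qed
  then show ?thesis
    using canonical_map_orbit simplicial_action.quotient_simplex[OF nerve_action] by metis
qed

end

end

theory Submission
  imports Defs
begin

text \<open>Condition (C) in degree \<open>t\<close> says that two morphisms of one orbit which leave the last vertex of
  a chain of \<open>t - 1\<close> morphisms are related by a group element that fixes the chain. Inserting identities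
  extends this to simplices of the nerve of any dimension \<open>p < t\<close> (\<open>condition_C_fixing\<close>). For
  \<open>p = 1\<close> it makes the orbit relation on morphisms compatible with composition, so that the
  morphisms of the quotient category are the orbits (\<open>condition_C_quot_rel\<close>).

  Let now \<open>\<sigma>\<close> and \<open>\<tau>\<close> be \<open>n\<close>-simplices of the nerve with the same image in the nerve of the quotient
  category, and let \<open>\<tau> = \<theta>\<^sup>* \<rho>\<close> with \<open>\<rho>\<close> of dimension \<open>k \<le> t\<close>. A group element that moves \<open>\<sigma>\<close> to \<open>\<tau>\<close>
  is found one arrow at a time (\<open>condition_C_same_orbit\<close>). If the next arrow of \<open>\<tau>\<close> is an
  identity, there is nothing to correct, since the only identity in an orbit with given source is
  the identity there. Otherwise \<open>\<theta> j < \<theta> (j + 1) \<le> t\<close>, and the correcting element can be chosen to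
  fix the front face of \<open>\<rho>\<close> with vertices \<open>0, \<dots>, \<theta> j\<close>, of which all earlier arrows of \<open>\<tau>\<close> are
  composites. Hence the canonical map \<open>\<lambda>\<close> is injective on \<open>t\<close>-skeleta.

  Conversely, injectivity in dimension \<open>t\<close> is applied to two chains that differ only in their last
  arrow (\<open>injective_condition_C\<close>). The last assertion holds because \<open>\<lambda>\<close> is surjective and a
  simplicial map that is bijective in every dimension is an isomorphism.\<close>

section \<open>Isomorphisms and skeleta of simplicial sets\<close>

lemma simplicial_iso_iff_bij_betw:
  assumes X: "simplicial_set X" and Y: "simplicial_set Y" and f: "simplicial_map X Y f"
  shows "simplicial_iso X Y f \<longleftrightarrow> (\<forall>n. bij_betw (f n) (Simp X n) (Simp Y n))"
proof
  assume "simplicial_iso X Y f"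
  then obtain f' where f': "simplicial_map Y X f'"
    "\<And>n x. x \<in> Simp X n \<Longrightarrow> f' n (f n x) = x" "\<And>n y. y \<in> Simp Y n \<Longrightarrow> f n (f' n y) = y"
    unfolding simplicial_iso_def by blast
  show "\<forall>n. bij_betw (f n) (Simp X n) (Simp Y n)"
  proof
    fix n
    show "bij_betw (f n) (Simp X n) (Simp Y n)"
      by (rule bij_betw_byWitness[where f' = "f' n"])
        (use f f' in \<open>auto simp: simplicial_map_def\<close>)
  qed
next
  interpret X: simplicial_set X by (rule X)
  interpret Y: simplicial_set Y by (rule Y)
  assume bij: "\<forall>n. bij_betw (f n) (Simp X n) (Simp Y n)"
  define f' where "f' n = inv_into (Simp X n) (f n)" for n
  have left: "f' n (f n x) = x" if "x \<in> Simp X n" for n x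
    unfolding f'_def by (rule bij_betw_inv_into_left[OF bij[rule_format] that])
  have right: "f n (f' n y) = y" if "y \<in> Simp Y n" for n y
    unfolding f'_def by (rule bij_betw_inv_into_right[OF bij[rule_format] that])
  have closed: "f' n y \<in> Simp X n" if "y \<in> Simp Y n" for n y
    using bij that unfolding f'_def bij_betw_def by (metis inv_into_into)
  have "f' m (Pull Y m n \<theta> y) = Pull X m n \<theta> (f' n y)"
    if \<theta>: "\<theta> \<in> simplex_maps m n" and y: "y \<in> Simp Y n" for m n \<theta> y
  proof -
    have "f m (Pull X m n \<theta> (f' n y)) = Pull Y m n \<theta> y"
      using f \<theta> closed[OF y] right[OF y] unfolding simplicial_map_def by metis
    then show ?thesis using left[OF X.pull_closed[OF \<theta> closed[OF y]]] by metis
  qed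
  then have "simplicial_map Y X f'" using closed unfolding simplicial_map_def by blast
  then show "simplicial_iso X Y f" using f left right unfolding simplicial_iso_def by blast
qed

lemma skeleton_subset:
  assumes "simplicial_set X"
  shows "Simp (skeleton t X) n \<subseteq> Simp X n"
  using simplicial_set.pull_closed[OF assms] unfolding skeleton_def by auto

lemma skeleton_low_dimension:
  assumes X: "simplicial_set X" and "n \<le> t"
  shows "Simp (skeleton t X) n = Simp X n"
proof
  have id: "restrict (\<lambda>i. i) {..n} \<in> simplex_maps n n"
    unfolding simplex_maps_def by (auto simp: mono_on_def)
  show "Simp X n \<subseteq> Simp (skeleton t X) n"
  proof
    fix x assume "x \<in> Simp X n"
    then show "x \<in> Simp (skeleton t X) n"
      using simplicial_set.pull_id[OF X, of x n, symmetric] id assms(2)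
      unfolding skeleton_def by auto
  qed
qed (rule skeleton_subset[OF X])

section \<open>The canonical map as a simplicial map\<close>

context category_action
begin

abbreviation quotient_nerve where
  "quotient_nerve \<equiv> simplicial_quotient G (nerve K) (nerve_act ao am)"

abbreviation lambda_map where "lambda_map \<equiv> canonical_map G K ao am"

lemma quotient_nerve_simplicial_set: "simplicial_set quotient_nerve"
  by (rule simplicial_action.simplicial_quotient_cocone(1)[OF nerve_action])

lemma canonical_map_iso_iff_inj:
  "simplicial_iso quotient_nerve (nerve Q) lambda_map
    \<longleftrightarrow> (\<forall>n. inj_on (lambda_map n) (Simp quotient_nerve n))"
proof -
  have "lambda_map n ` Simp quotient_nerve n = Simp (nerve Q) n" for n
    using canonical_map_simplicial canonical_map_surj[of _ n] unfolding simplicial_map_def by blast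
  then show ?thesis
    using simplicial_iso_iff_bij_betw[OF quotient_nerve_simplicial_set
        category.nerve_simplicial_set[OF quotient_is_category] canonical_map_simplicial]
    by (simp add: bij_betw_def)
qed

section \<open>Consequences of the condition\<close>

lemma in_orbit_mor: "m \<in> Mor K \<Longrightarrow> m \<in> orbit G am m"
  unfolding orbit_def using act_one_mor[of m] one_closed by force

lemma orbit_mor_act:
  assumes g: "g \<in> carrier G" and m: "m \<in> Mor K"
  shows "orbit G am (am g m) = orbit G am m"
proof -
  have "am h m \<in> orbit G am (am g m)" if h: "h \<in> carrier G" for h
  proof -
    have "am (h \<otimes> inv g) (am g m) = am (h \<otimes> inv g \<otimes> g) m"
      using act_mult_mor[of "h \<otimes> inv g" g m] g h m by simp
    also have "h \<otimes> inv g \<otimes> g = h" using g h by (simp add: m_assoc)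
    finally show ?thesis
      unfolding orbit_def using g h by (intro CollectI exI[of _ "h \<otimes> inv g"]) simp
  qed
  moreover have "am h (am g m) \<in> orbit G am m" if h: "h \<in> carrier G" for h
    unfolding orbit_def using act_mult_mor[OF h g m, symmetric] h g by blast
  ultimately show ?thesis unfolding orbit_def by blast
qed

lemma orbit_eq_morD:
  assumes "orbit G am m = orbit G am n" and "n \<in> Mor K"
  obtains g where "g \<in> carrier G" "n = am g m"
  using assms in_orbit_mor[of n] unfolding orbit_def by blast

lemma nerve_act_arrow:
  assumes "\<sigma> \<in> Simp (nerve K) n" "i < n"
  shows "arrows (nerve_act ao am g \<sigma>) ! i = am g (arrows \<sigma> ! i)"
  using nerve_simplexD(1)[OF assms(1)] assms(2) by (cases \<sigma>) (auto simp: nerve_act_def)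

lemma nerve_act_vertex:
  assumes "g \<in> carrier G" "\<sigma> \<in> Simp (nerve K) n" "i \<le> n"
  shows "vertex K (nerve_act ao am g \<sigma>) i = ao g (vertex K \<sigma> i)"
  unfolding nerve_act_def by (rule category_functor.vertex_map[OF act_functor[OF assms(1)] assms(2,3)])

lemma nerve_act_eqI:
  assumes g: "g \<in> carrier G" and \<sigma>: "\<sigma> \<in> Simp (nerve K) n" and \<tau>: "\<tau> \<in> Simp (nerve K) n"
    and "ao g (vertex K \<sigma> 0) = vertex K \<tau> 0" and "\<And>i. i < n \<Longrightarrow> am g (arrows \<sigma> ! i) = arrows \<tau> ! i"
  shows "nerve_act ao am g \<sigma> = \<tau>"
  by (rule nerve_simplex_eqI[OF simplicial_action.act_closed[OF nerve_action g \<sigma>] \<tau>])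
    (use assms(4,5) in \<open>simp_all add: nerve_act_vertex[OF g \<sigma>] nerve_act_arrow[OF \<sigma>]\<close>)

lemma condition_C_fixing_top:
  assumes C: "condition_C G K am t" and t: "t \<ge> 2" and \<sigma>: "\<sigma> \<in> Simp (nerve K) (t - 1)"
    and a: "a \<in> Mor K" "Src K a = vertex K \<sigma> (t - 1)"
    and b: "b \<in> Mor K" "Src K b = vertex K \<sigma> (t - 1)"
    and ab: "orbit G am a = orbit G am b"
  shows "\<exists>g \<in> carrier G. am g a = b \<and> nerve_act ao am g \<sigma> = \<sigma>"
proof -
  define m where "m i = arrows \<sigma> ! (i - 1)" for i
  have mor: "\<forall>i \<in> {1..t-1}. m i \<in> Mor K"
    unfolding m_def using nerve_simplexD(2)[OF \<sigma>] by auto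
  have tgt: "Tgt K (m i) = vertex K \<sigma> i" if "i \<in> {1..t-1}" for i
    unfolding m_def using nerve_simplexD(4)[OF \<sigma>, of "i - 1"] that by auto
  have src: "Src K (m i) = vertex K \<sigma> (i - 1)" if "i \<in> {1..t-1}" for i
    unfolding m_def using nerve_simplexD(3)[OF \<sigma>, of "i - 1"] that by auto
  have chain: "\<forall>i \<in> {2..t-1}. Src K (m i) = Tgt K (m (i - 1))"
  proof
    fix i assume "i \<in> {2..t-1}"
    then have "i \<in> {1..t-1}" "i - 1 \<in> {1..t-1}" by auto
    then show "Src K (m i) = Tgt K (m (i - 1))" using src tgt by metis
  qed
  have "Tgt K (m (t - 1)) = vertex K \<sigma> (t - 1)" using tgt t by simp
  then obtain g where g: "g \<in> carrier G" "am g a = b" and fixed: "\<forall>i \<in> {1..t-1}. am g (m i) = m i"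
    using C[unfolded condition_C_def, rule_format, of m a b] mor chain a b ab by auto
  have arr: "am g (arrows \<sigma> ! i) = arrows \<sigma> ! i" if "i < t - 1" for i
    using fixed[rule_format, of "Suc i"] that unfolding m_def by simp
  have "ao g (vertex K \<sigma> 0) = vertex K \<sigma> 0"
    using src_am[OF g(1), of "arrows \<sigma> ! 0"] arr[of 0] nerve_simplexD(2,3)[OF \<sigma>, of 0] t by simp
  then show ?thesis using nerve_act_eqI[OF g(1) \<sigma> \<sigma>] arr g by blast
qed

text \<open>The general case follows from \<open>p = t - 1\<close>: the \<open>p\<close>-simplex is a face of the simplex obtained
  by putting \<open>t - 1 - p\<close> identities in front of it, and a group element that fixes a simplex fixes its
  faces.\<close>

lemma condition_C_fixing:
  assumes C: "condition_C G K am t" and t: "t \<ge> 2" and p: "p < t" and \<sigma>: "\<sigma> \<in> Simp (nerve K) p"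
    and a: "a \<in> Mor K" "Src K a = vertex K \<sigma> p"
    and b: "b \<in> Mor K" "Src K b = vertex K \<sigma> p"
    and ab: "orbit G am a = orbit G am b"
  shows "\<exists>g \<in> carrier G. am g a = b \<and> nerve_act ao am g \<sigma> = \<sigma>"
proof -
  interpret N: simplicial_action G "nerve K" "nerve_act ao am" by (rule nerve_action)
  let ?r = "t - 1 - p"
  \<comment> \<open>Subtraction on the naturals truncates, so \<open>s\<close> sends the first \<open>?r + 1\<close> vertices to \<open>0\<close>.\<close>
  define s where "s = restrict (\<lambda>i. i - ?r) {..t - 1}"
  define d where "d = restrict (\<lambda>i. i + ?r) {..p}"
  have s: "s \<in> simplex_maps (t - 1) p" and d: "d \<in> simplex_maps p (t - 1)"
    using p unfolding s_def d_def simplex_maps_def by (auto simp: mono_on_def)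
  have ds: "compose {..p} s d = restrict (\<lambda>i. i) {..p}"
    using p unfolding s_def d_def compose_def by (auto simp: restrict_def fun_eq_iff)
  let ?\<sigma> = "Pull (nerve K) (t - 1) p s \<sigma>"
  have \<sigma>': "?\<sigma> \<in> Simp (nerve K) (t - 1)" by (rule pull_closed[OF s \<sigma>])
  have "s (t - 1) = p" using p unfolding s_def by simp
  then have "vertex K ?\<sigma> (t - 1) = vertex K \<sigma> p" using vertex_pull[OF s \<sigma>, of "t - 1"] by simp
  then obtain g where g: "g \<in> carrier G" "am g a = b" "nerve_act ao am g ?\<sigma> = ?\<sigma>"
    using condition_C_fixing_top[OF C t \<sigma>' a(1) _ b(1) _ ab] a(2) b(2) by auto
  have "Pull (nerve K) p (t - 1) d ?\<sigma> = \<sigma>"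
    using N.pull_comp[OF d s \<sigma>] N.pull_id[OF \<sigma>] ds by simp
  then have "nerve_act ao am g \<sigma> = \<sigma>" using N.act_pull[OF g(1) d \<sigma>'] g(3) by simp
  then show ?thesis using g by blast
qed

text \<open>For composable \<open>m\<close>, \<open>n\<close> and \<open>m' = g m\<close>, \<open>n'\<close>, some \<open>h\<close> fixes \<open>m'\<close> and moves \<open>g n\<close> to \<open>n'\<close>;
  then \<open>h g\<close> moves the composite of \<open>m\<close>, \<open>n\<close> to that of \<open>m'\<close>, \<open>n'\<close>.\<close>

lemma condition_C_quot_rel:
  assumes C: "condition_C G K am t" and t: "t \<ge> 2" and "quot_rel G K am m n"
  shows "orbit G am m = orbit G am n"
  using assms(3)
proof induction
  case (act m g)
  then show ?case by (simp add: orbit_mor_act)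
next
  case (comp m m' n n')
  have mor: "m \<in> Mor K" "m' \<in> Mor K" "n \<in> Mor K" "n' \<in> Mor K"
    using quot_rel_facts comp.hyps(1,2) by blast+
  obtain g where g: "g \<in> carrier G" "m' = am g m"
    using orbit_eq_morD[OF comp.IH(1) mor(2)] .
  have gn: "am g n \<in> Mor K" "Src K (am g n) = Tgt K m'"
    using g mor comp.hyps by (simp_all add: am_closed src_am tgt_am)
  have \<sigma>: "Chain [m'] \<in> Simp (nerve K) 1" using mor by (simp add: nerve_def)
  have orbit: "orbit G am (am g n) = orbit G am n'"
    using comp.IH(2) g mor by (simp add: orbit_mor_act)
  have "\<exists>h \<in> carrier G. am h (am g n) = n' \<and> nerve_act ao am h (Chain [m']) = Chain [m']"
    by (rule condition_C_fixing[OF C t _ \<sigma> gn(1) _ mor(4) _ orbit])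
      (use gn(2) comp.hyps(4) t in simp_all)
  then obtain h where h: "h \<in> carrier G" "am h (am g n) = n'" "am h m' = m'"
    by (auto simp: nerve_act_def)
  have act_comp: "am k (Comp K x y) = Comp K (am k x) (am k y)"
    if "k \<in> carrier G" "x \<in> Mor K" "y \<in> Mor K" "Tgt K x = Src K y" for k x y
    by (rule category_functor.map_comp[OF act_functor[OF that(1)] that(2-4)])
  have "am h (am g (Comp K m n)) = Comp K m' n'"
    using act_comp g h mor gn comp.hyps(3) by simp
  then show ?case
    using orbit_mor_act[OF h(1) am_closed[OF g(1)]] orbit_mor_act[OF g(1)] mor comp.hyps(3)
    by (metis comp_closed)
qed auto

section \<open>Injectivity on skeleta\<close>

text \<open>Only \<open>\<tau>\<close> is required to lie in the \<open>t\<close>-skeleton.\<close>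

lemma condition_C_same_orbit:
  assumes C: "condition_C G K am t" and t: "t \<ge> 2" and k: "k \<le> t"
    and \<sigma>: "\<sigma> \<in> Simp (nerve K) n" and \<rho>: "\<rho> \<in> Simp (nerve K) k" and \<theta>: "\<theta> \<in> simplex_maps n k"
    and \<tau>_def: "\<tau> = Pull (nerve K) n k \<theta> \<rho>"
    and eq: "map_nerve_simplex (orbit G ao) (mor_class G K am) \<sigma>
      = map_nerve_simplex (orbit G ao) (mor_class G K am) \<tau>"
  shows "\<exists>g \<in> carrier G. nerve_act ao am g \<sigma> = \<tau>"
proof -
  have \<tau>: "\<tau> \<in> Simp (nerve K) n" unfolding \<tau>_def by (rule pull_closed[OF \<theta> \<rho>])
  have vertex0: "orbit G ao (vertex K \<sigma> 0) = orbit G ao (vertex K \<tau> 0)"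
    using category_functor.vertex_map[OF quotient_functor \<sigma>]
      category_functor.vertex_map[OF quotient_functor \<tau>] eq by (metis le0)
  have orbits: "orbit G am (arrows \<sigma> ! i) = orbit G am (arrows \<tau> ! i)" if i: "i < n" for i
  proof -
    have "map (mor_class G K am) (arrows \<sigma>) ! i = map (mor_class G K am) (arrows \<tau>) ! i"
      using eq by (metis category_functor.arrows_map[OF quotient_functor])
    then have "quot_rel G K am (arrows \<sigma> ! i) (arrows \<tau> ! i)"
      using i nerve_simplexD[OF \<sigma>] nerve_simplexD[OF \<tau>] by (simp add: mor_class_eq_iff)
    then show ?thesis by (rule condition_C_quot_rel[OF C t])
  qed
  have "\<exists>g \<in> carrier G. ao g (vertex K \<sigma> 0) = vertex K \<tau> 0
      \<and> (\<forall>i < j. am g (arrows \<sigma> ! i) = arrows \<tau> ! i) \<and> ao g (vertex K \<sigma> j) = vertex K \<tau> j"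
    if "j \<le> n" for j
    using that
  proof (induction j)
    case 0
    then show ?case using orbit_eq_objD[OF vertex0 nerve_simplexD(5)[OF \<tau>]] by (metis le0 not_less0)
  next
    case (Suc j)
    then have j: "j < n" by simp
    obtain g where g: "g \<in> carrier G" "ao g (vertex K \<sigma> 0) = vertex K \<tau> 0"
      "\<forall>i < j. am g (arrows \<sigma> ! i) = arrows \<tau> ! i" "ao g (vertex K \<sigma> j) = vertex K \<tau> j"
      using Suc by auto
    define a where "a = am g (arrows \<sigma> ! j)"
    define b where "b = arrows \<tau> ! j"
    have a: "a \<in> Mor K" "Src K a = vertex K \<tau> j"
      using nerve_simplexD[OF \<sigma>] j g by (simp_all add: a_def am_closed src_am)
    have b: "b \<in> Mor K" "Src K b = vertex K \<tau> j" "Tgt K b = vertex K \<tau> (Suc j)"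
      using nerve_simplexD[OF \<tau>] j by (simp_all add: b_def)
    have ab: "orbit G am a = orbit G am b"
      using orbits[OF j] nerve_simplexD[OF \<sigma>] j g by (simp add: a_def b_def orbit_mor_act)
    have b_edge: "b = edge K \<rho> (\<theta> j) (\<theta> (Suc j))"
      unfolding b_def \<tau>_def by (rule arrows_pull[OF j])
    have v_j: "vertex K \<tau> i = vertex K \<rho> (\<theta> i)" if "i \<le> n" for i
      unfolding \<tau>_def by (rule vertex_pull[OF \<theta> \<rho> that])
    have "\<exists>h \<in> carrier G. am h a = b \<and> ao h (vertex K \<tau> 0) = vertex K \<tau> 0
      \<and> (\<forall>i < j. am h (arrows \<tau> ! i) = arrows \<tau> ! i)"
    proof (cases "\<theta> j = \<theta> (Suc j)")
      case True
      \<comment> \<open>\<open>b\<close> is an identity, hence so is \<open>a\<close>, and both have the same source.\<close>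
      then have b_id: "b = Ident K (vertex K \<tau> j)" using b_edge v_j j by (simp add: edge_refl)
      obtain h where h: "h \<in> carrier G" "a = am h b" using orbit_eq_morD[OF ab[symmetric] a(1)] .
      have "vertex K \<tau> j \<in> Obj K" using nerve_simplexD(5)[OF \<tau>] j by simp
      then have "a = Ident K (Src K a)"
        using h b_id by (simp add: ident_am src_ident ao_closed)
      then have "a = b" using a b_id by simp
      then show ?thesis
        using act_one_mor a nerve_simplexD[OF \<tau>] j act_one_obj
        by (intro bexI[of _ "\<one>"]) auto
    next
      case False
      then have lt: "\<theta> j < \<theta> (Suc j)" "\<theta> (Suc j) \<le> k"
        using simplex_mapsD[OF \<theta>] j by (simp_all add: le_neq_implies_less)
      \<comment> \<open>\<open>\<phi>\<close> is the front face of \<open>\<rho>\<close>, whose last vertex is the source of \<open>a\<close> and \<open>b\<close>.\<close>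
      define \<iota> where "\<iota> = restrict (\<lambda>i. i) {..\<theta> j}"
      have \<iota>: "\<iota> \<in> simplex_maps (\<theta> j) k"
        using lt unfolding \<iota>_def simplex_maps_def by (auto simp: mono_on_def)
      define \<phi> where "\<phi> = Pull (nerve K) (\<theta> j) k \<iota> \<rho>"
      have \<phi>: "\<phi> \<in> Simp (nerve K) (\<theta> j)" unfolding \<phi>_def by (rule pull_closed[OF \<iota> \<rho>])
      have \<phi>_vertex: "vertex K \<phi> i = vertex K \<rho> i" if "i \<le> \<theta> j" for i
        using vertex_pull[OF \<iota> \<rho> that] that by (simp add: \<phi>_def \<iota>_def)
      have \<phi>_edge: "edge K \<phi> i i' = edge K \<rho> i i'" if "i \<le> i'" "i' \<le> \<theta> j" for i i'
        using edge_pull[OF \<iota> \<rho> that] that by (simp add: \<phi>_def \<iota>_def)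
      have "vertex K \<phi> (\<theta> j) = vertex K \<tau> j" using \<phi>_vertex v_j j by simp
      moreover have "\<theta> j < t" using lt k by simp
      ultimately obtain h where h: "h \<in> carrier G" "am h a = b" "nerve_act ao am h \<phi> = \<phi>"
        using condition_C_fixing[OF C t _ \<phi> a(1) _ b(1) _ ab] a(2) b(2) by auto
      have "ao h (vertex K \<tau> 0) = vertex K \<tau> 0"
        using nerve_act_vertex[OF h(1) \<phi>, of "\<theta> 0"] h(3) \<phi>_vertex[of "\<theta> 0"] v_j[of 0]
          simplex_mapsD(2)[OF \<theta>, of 0 j] j by simp
      moreover have "am h (arrows \<tau> ! i) = arrows \<tau> ! i" if i: "i < j" for i
      proof -
        have le: "\<theta> i \<le> \<theta> (Suc i)" "\<theta> (Suc i) \<le> \<theta> j"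
          using simplex_mapsD(2)[OF \<theta>] i j by simp_all
        have "arrows \<tau> ! i = edge K \<phi> (\<theta> i) (\<theta> (Suc i))"
          using i j \<phi>_edge[OF le] unfolding \<tau>_def by (simp add: arrows_pull)
        then show ?thesis
          using category_functor.edge_map[OF act_functor[OF h(1)] \<phi> le] h(3)
          by (simp add: nerve_act_def)
      qed
      ultimately show ?thesis using h by blast
    qed
    then obtain h where h: "h \<in> carrier G" "am h a = b" "ao h (vertex K \<tau> 0) = vertex K \<tau> 0"
      "\<forall>i < j. am h (arrows \<tau> ! i) = arrows \<tau> ! i" by blast
    have arr: "am (h \<otimes> g) (arrows \<sigma> ! i) = arrows \<tau> ! i" if "i < Suc j" for i
      using that g h nerve_simplexD[OF \<sigma>] j
      by (cases "i = j") (simp_all add: act_mult_mor a_def b_def)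
    moreover have "ao (h \<otimes> g) (vertex K \<sigma> 0) = vertex K \<tau> 0"
      using g h nerve_simplexD(5)[OF \<sigma>, of 0] by (simp add: act_mult_obj)
    moreover have "ao (h \<otimes> g) (vertex K \<sigma> (Suc j)) = vertex K \<tau> (Suc j)"
      using tgt_am[of "h \<otimes> g" "arrows \<sigma> ! j"] arr[of j] g h nerve_simplexD[OF \<sigma>] b(3) j
      by (simp add: b_def)
    ultimately show ?case using g h by (intro bexI[of _ "h \<otimes> g"]) auto
  qed
  then obtain g where "g \<in> carrier G" "ao g (vertex K \<sigma> 0) = vertex K \<tau> 0"
    "\<forall>i < n. am g (arrows \<sigma> ! i) = arrows \<tau> ! i" by blast
  then show ?thesis using nerve_act_eqI[OF _ \<sigma> \<tau>] by blast
qed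

lemma condition_C_injective:
  assumes C: "condition_C G K am t" and t: "t \<ge> 2"
  shows "injective_on_skeleta t quotient_nerve lambda_map"
  unfolding injective_on_skeleta_def
proof (intro allI inj_onI)
  interpret N: simplicial_action G "nerve K" "nerve_act ao am" by (rule nerve_action)
  fix n S T
  assume S: "S \<in> Simp (skeleton t quotient_nerve) n" and T: "T \<in> Simp (skeleton t quotient_nerve) n"
    and eq: "lambda_map n S = lambda_map n T"
  obtain \<sigma> where \<sigma>: "\<sigma> \<in> Simp (nerve K) n" "S = orbit G (nerve_act ao am) \<sigma>"
    using S skeleton_subset[OF quotient_nerve_simplicial_set] N.quotient_simplexE by blast
  obtain k \<theta> R where R: "T = Pull quotient_nerve n k \<theta> R" "k \<le> t" "\<theta> \<in> simplex_maps n k"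
    "R \<in> Simp quotient_nerve k"
    using T unfolding skeleton_def by auto
  obtain \<rho> where \<rho>: "\<rho> \<in> Simp (nerve K) k" "R = orbit G (nerve_act ao am) \<rho>"
    using R(4) N.quotient_simplexE by blast
  let ?\<tau> = "Pull (nerve K) n k \<theta> \<rho>"
  have T: "T = orbit G (nerve_act ao am) ?\<tau>" using R \<rho> N.pull_orbit by simp
  have "map_nerve_simplex (orbit G ao) (mor_class G K am) \<sigma>
      = map_nerve_simplex (orbit G ao) (mor_class G K am) ?\<tau>"
    using eq canonical_map_orbit[OF \<sigma>(1)] canonical_map_orbit[OF pull_closed[OF R(3) \<rho>(1)]]
    by (simp add: \<sigma>(2) T)
  then obtain g where "g \<in> carrier G" "nerve_act ao am g \<sigma> = ?\<tau>"
    using condition_C_same_orbit[OF C t R(2) \<sigma>(1) \<rho>(1) R(3) refl] by blast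
  then show "S = T" using N.orbit_act[OF _ \<sigma>(1)] \<sigma>(2) T by metis
qed

lemma injective_condition_C:
  assumes inj: "inj_on (lambda_map t) (Simp quotient_nerve t)" and t: "t \<ge> 1"
  shows "condition_C G K am t"
  unfolding condition_C_def
proof (intro allI impI, elim conjE)
  interpret N: simplicial_action G "nerve K" "nerve_act ao am" by (rule nerve_action)
  fix m a b
  assume m: "\<forall>i \<in> {1..t-1}. m i \<in> Mor K" and a: "a \<in> Mor K" and b: "b \<in> Mor K"
    and chain: "\<forall>i \<in> {2..t-1}. Src K (m i) = Tgt K (m (i - 1))"
    and src: "Src K a = Tgt K (m (t - 1))" "Src K b = Tgt K (m (t - 1))"
    and ab: "orbit G am a = orbit G am b"
  define ch :: "'m \<Rightarrow> ('o, 'm) nerve_simplex" where "ch x = Chain (map m [1..<t] @ [x])" for x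
  have ch: "ch x \<in> Simp (nerve K) t" if x: "x \<in> Mor K" "Src K x = Tgt K (m (t - 1))" for x
  proof -
    let ?ms = "map m [1..<t] @ [x]"
    have "Tgt K (?ms ! i) = Src K (?ms ! Suc i)" if i: "Suc i < t" for i
    proof (cases "Suc (Suc i) < t")
      case True
      then show ?thesis using chain[rule_format, of "Suc (Suc i)"] by (auto simp: nth_append)
    next
      case False
      then have "t = Suc (Suc i)" using i by simp
      then show ?thesis using x by (simp add: nth_append)
    qed
    then show ?thesis using t m x unfolding ch_def nerve_def by auto
  qed
  note ch_a = ch[OF a src(1)] and ch_b = ch[OF b src(2)]
  obtain h where "h \<in> carrier G" "b = am h a" using orbit_eq_morD[OF ab b] .
  then have "mor_class G K am a = mor_class G K am b" using mor_class_act a by simp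
  then have "lambda_map t (orbit G (nerve_act ao am) (ch a))
      = lambda_map t (orbit G (nerve_act ao am) (ch b))"
    by (simp add: canonical_map_orbit[OF ch_a] canonical_map_orbit[OF ch_b]) (simp add: ch_def)
  then have "orbit G (nerve_act ao am) (ch a) = orbit G (nerve_act ao am) (ch b)"
    using inj N.quotient_simplex[OF ch_a] N.quotient_simplex[OF ch_b] by (meson inj_onD)
  then have "ch b \<in> orbit G (nerve_act ao am) (ch a)" using N.in_orbit[OF ch_b] by simp
  then obtain g where g: "g \<in> carrier G" "nerve_act ao am g (ch a) = ch b"
    unfolding orbit_def by auto
  then have "am g a = b" and "map (am g \<circ> m) [1..<t] = map m [1..<t]"
    by (simp_all add: ch_def nerve_act_def)
  then show "\<exists>g \<in> carrier G. am g a = b \<and> (\<forall>i \<in> {1..t-1}. am g (m i) = m i)"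
    using g(1) by (intro bexI[of _ g]) auto
qed

lemma condition_C_iff_injective:
  assumes t: "t \<ge> 2"
  shows "condition_C G K am t \<longleftrightarrow> injective_on_skeleta t quotient_nerve lambda_map"
proof
  assume "injective_on_skeleta t quotient_nerve lambda_map"
  then have "inj_on (lambda_map t) (Simp quotient_nerve t)"
    unfolding injective_on_skeleta_def
    by (metis skeleton_low_dimension[OF quotient_nerve_simplicial_set] order_refl)
  then show "condition_C G K am t" using injective_condition_C t by simp
qed (rule condition_C_injective[OF _ t])

lemma canonical_map_iso_iff_condition_C:
  "simplicial_iso quotient_nerve (nerve Q) lambda_map \<longleftrightarrow> (\<forall>t \<ge> 2. condition_C G K am t)"
proof
  assume "simplicial_iso quotient_nerve (nerve Q) lambda_map"
  then show "\<forall>t \<ge> 2. condition_C G K am t"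
    using injective_condition_C by (simp add: canonical_map_iso_iff_inj)
next
  assume C: "\<forall>t \<ge> 2. condition_C G K am t"
  have "inj_on (lambda_map n) (Simp quotient_nerve n)" for n
  proof -
    have "injective_on_skeleta (n + 2) quotient_nerve lambda_map" using C condition_C_injective by simp
    then show ?thesis
      unfolding injective_on_skeleta_def
      by (metis skeleton_low_dimension[OF quotient_nerve_simplicial_set] le_add1)
  qed
  then show "simplicial_iso quotient_nerve (nerve Q) lambda_map" by (simp add: canonical_map_iso_iff_inj)
qed

end

section \<open>The equivalence\<close>

theorem theorem3p4:
  fixes G :: "('g, 'b) monoid_scheme"
    and K :: "('o, 'm) category"
    and ao :: "'g \<Rightarrow> 'o \<Rightarrow> 'o"
    and am :: "'g \<Rightarrow> 'm \<Rightarrow> 'm"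
  assumes "category_action G K ao am"
  shows "(\<forall>t \<ge> 2. condition_C G K am t \<longleftrightarrow>
      injective_on_skeleta t (simplicial_quotient G (nerve K) (nerve_act ao am)) (canonical_map G K ao am))
    \<and> (simplicial_iso (simplicial_quotient G (nerve K) (nerve_act ao am))
        (nerve (quotient_category G K ao am)) (canonical_map G K ao am)
      \<longleftrightarrow> (\<forall>t \<ge> 2. condition_C G K am t))"
proof -
  interpret category_action G K ao am by (rule assms)
  show ?thesis using condition_C_iff_injective canonical_map_iso_iff_condition_C by blast
qed

end
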